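(* For all integers $n\ge 1$ and $0\le k\le n^2$, $i_B(n,k)$ counts the tilings of an $(n+k)\times 1$-board using exactly $n$ green squares and $k$ orange squares, where the number of successive orange squares is at most $2j-1$ if there are $j$ green squares before them; that is, $$i_B(n,k)=|\mathcal{T}^{B}_{n,k}|.$$
   Context: $B_n$ is the hyperoctahedral group: the group of bijections $\pi$ of $\{-n,\ldots,-1,1,\ldots,n\}$ with $\pi(-j)=-\pi(j)$ for all $j\in\{1,\dots,n\}$. Every $\pi\in B_n$ is written uniquely as $\pi(p)=(-1)^{r_p}\sigma_p$ for $1\le p\le n$, with $r_p\in\{0,1\}$ and $\sigma=\sigma_1\cdots\sigma_n$ a permutation of $\{1,\dots,n\}$. For $1\le i\le n$ put $m=n+1-i$ and $inv_i(\sigma)=|\{j: j<m,\ \sigma_j>\sigma_m\}|$, and define $inv_i(\pi)=inv_i(\sigma)$ if $r_m=0$, and $inv_i(\pi)=1+2|\{j: j<m,\ \sigma_j<\sigma_m\}|+inv_i(\sigma)$ if $r_m=1$. The number of inversions of type $B$ of $\pi$ is $inv_B(\pi)=\sum_{i=1}^n inv_i(\pi)$. The Mahonian number of type $B$ is $i_B(n,k)=|\{\pi\in B_n: inv_B(\pi)=k\}|$. $\mathcal{T}^{B}_{n,k}$ is the set of tilings of an $(n+k)\times 1$-board (equivalently, words of length $n+k$ in the letters green, orange) with exactly $n$ green squares and $k$ orange squares, such that every nonempty maximal run of consecutive orange squares having exactly $j$ green squares to its left has length at most $2j-1$ (in particular no orange square precedes the first green square). *)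

theory Defs
  imports "HOL-Combinatorics.Permutations"
begin

text \<open>
  A bijection of \<open>{-n, \<dots>, -1, 1, \<dots>, n}\<close> is represented by its extension to \<^typ>\<open>int\<close> that fixes
  every other integer (the library's \<^const>\<open>permutes\<close>), so that distinct bijections correspond to
  distinct functions.
\<close>

definition signed_range :: "nat \<Rightarrow> int set" where
  "signed_range n = {- int n..int n} - {0}"

definition hyperoctahedral :: "nat \<Rightarrow> (int \<Rightarrow> int) set" where
  "hyperoctahedral n =
     {\<pi>. \<pi> permutes signed_range n \<and> (\<forall>j\<in>{1..int n}. \<pi> (- j) = - \<pi> j)}"

text \<open>
  The unique decomposition \<open>\<pi>(p) = (-1)^(r p) * \<sigma> p\<close> for \<open>1 \<le> p \<le> n\<close>, with \<open>r p \<in> {0, 1}\<close> and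
  \<open>\<sigma>\<close> a permutation of \<open>{1, \<dots>, n}\<close>; see \<open>hyperoctahedral_decomp\<close> and
  \<open>bij_betw_unsigned\<close> below.
\<close>

definition sign_bit :: "(int \<Rightarrow> int) \<Rightarrow> nat \<Rightarrow> nat" where
  "sign_bit \<pi> p = (if \<pi> (int p) < 0 then 1 else 0)"

definition unsigned :: "(int \<Rightarrow> int) \<Rightarrow> nat \<Rightarrow> nat" where
  "unsigned \<pi> p = nat \<bar>\<pi> (int p)\<bar>"

lemma hyperoctahedral_decomp:
  "\<pi> (int p) = (- 1) ^ sign_bit \<pi> p * int (unsigned \<pi> p)"
  by (simp add: sign_bit_def unsigned_def)

lemma bij_betw_unsigned:
  assumes "\<pi> \<in> hyperoctahedral n"
  shows "bij_betw (unsigned \<pi>) {1..n} {1..n}"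
proof -
  have perm: "\<pi> permutes signed_range n" and odd: "\<And>j. j \<in> {1..int n} \<Longrightarrow> \<pi> (- j) = - \<pi> j"
    using assms by (auto simp: hyperoctahedral_def)
  have maps: "unsigned \<pi> ` {1..n} \<subseteq> {1..n}"
  proof
    fix y assume "y \<in> unsigned \<pi> ` {1..n}"
    then obtain p where p: "p \<in> {1..n}" "y = unsigned \<pi> p" by blast
    then have "int p \<in> signed_range n" by (simp add: signed_range_def)
    then have "\<pi> (int p) \<in> signed_range n" using permutes_in_image[OF perm] by blast
    then show "y \<in> {1..n}" using p by (auto simp: signed_range_def unsigned_def)
  qed
  have inj: "inj_on (unsigned \<pi>) {1..n}"
  proof (rule inj_onI)
    fix p q assume p: "p \<in> {1..n}" and q: "q \<in> {1..n}" and "unsigned \<pi> p = unsigned \<pi> q"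
    then have "\<pi> (int p) = \<pi> (int q) \<or> \<pi> (int p) = - \<pi> (int q)"
      by (simp add: unsigned_def) linarith
    then have "\<pi> (int p) = \<pi> (int q) \<or> \<pi> (int p) = \<pi> (- int q)"
      using odd[of "int q"] q by simp
    then have "int p = int q \<or> int p = - int q"
      by (simp add: inj_eq[OF permutes_inj[OF perm]])
    then show "p = q" using p q by auto
  qed
  show ?thesis
    using endo_inj_surj[OF _ maps inj] inj by (simp add: bij_betw_def)
qed

text \<open>
  Both statistics are indexed by \<open>i \<in> {1, \<dots>, n}\<close>, counting positions from the right:
  \<open>i\<close> refers to position \<open>n + 1 - i\<close>.
\<close>

definition inv_at :: "nat \<Rightarrow> nat \<Rightarrow> (nat \<Rightarrow> nat) \<Rightarrow> nat" where
  "inv_at n i \<sigma> = (let m = n + 1 - i in card {j \<in> {1..n}. j < m \<and> \<sigma> j > \<sigma> m})"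

definition inv_at_B :: "nat \<Rightarrow> nat \<Rightarrow> (int \<Rightarrow> int) \<Rightarrow> nat" where
  "inv_at_B n i \<pi> =
     (let m = n + 1 - i; \<sigma> = unsigned \<pi> in
        if sign_bit \<pi> m = 0 then inv_at n i \<sigma>
        else 1 + 2 * card {j \<in> {1..n}. j < m \<and> \<sigma> j < \<sigma> m} + inv_at n i \<sigma>)"

definition inv_B :: "nat \<Rightarrow> (int \<Rightarrow> int) \<Rightarrow> nat" where
  "inv_B n \<pi> = (\<Sum>i = 1..n. inv_at_B n i \<pi>)"

definition mahonian_B :: "nat \<Rightarrow> nat \<Rightarrow> nat" where
  "mahonian_B n k = card {\<pi> \<in> hyperoctahedral n. inv_B n \<pi> = k}"

datatype square = Green | Orange

text \<open>
  In a word \<open>u @ replicate l Orange @ v\<close> the middle block is a nonempty maximal run of orange squares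
  iff \<open>l \<ge> 1\<close>, \<open>u\<close> does not end in an orange square and \<open>v\<close> does not begin with one.
  The bound \<open>2 * j - 1\<close> is taken in \<^typ>\<open>int\<close>; for \<open>j = 0\<close> it is negative and so rules out any
  orange square before the first green one.
\<close>

definition tilings_B :: "nat \<Rightarrow> nat \<Rightarrow> square list set" where
  "tilings_B n k =
     {w. length w = n + k \<and> count_list w Green = n \<and> count_list w Orange = k \<and>
         (\<forall>u l v. w = u @ replicate l Orange @ v \<and> l \<ge> 1 \<and>
                  (u = [] \<or> last u = Green) \<and> (v = [] \<or> hd v = Green) \<longrightarrow>
                  int l \<le> 2 * int (count_list u Green) - 1)}"

end

theory Submission
  imports Defs
begin

text \<open>
  Both sides count the sequences \<open>(c\<^sub>1, \<dots>, c\<^sub>n)\<close> with \<open>0 \<le> c\<^sub>j \<le> 2 * j - 1\<close> and sum \<open>k\<close>; that is,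
  both generating functions in \<open>k\<close> equal \<open>\<Prod>j=1..n. (1 + q + \<dots> + q ^ (2 * j - 1))\<close>.

  For tilings, \<open>c\<^sub>j\<close> is the number of orange squares directly after the \<open>j\<close>-th green one.
  Removing the last green square together with the orange squares after it leaves a tiling with one
  green square less, and the run so removed is subject only to its own bound (\<open>tilings_B_Suc\<close>).

  For signed permutations, \<open>c\<^sub>m\<close> is the contribution of position \<open>m\<close> to \<^const>\<open>inv_B\<close>. The key
  observation is that the two cases of its definition are one and the same quantity
  (\<open>inv_at_B_eq_rank\<close>): let \<open>S\<^sub>m\<close> consist of the \<open>2 * m\<close> values \<open>\<pi>(j)\<close> and \<open>-\<pi>(j)\<close>
  for \<open>1 \<le> j \<le> m\<close>; then \<open>c\<^sub>m\<close> is the number of elements of \<open>S\<^sub>m\<close> above \<open>\<pi>(m)\<close>. Now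
  read \<open>\<pi>(n), \<pi>(n - 1), \<dots>, \<pi>(1)\<close>. When \<open>\<pi>(m)\<close> has to be chosen, \<open>S\<^sub>m\<close> is exactly the set of
  values still available, and ranking is a bijection from \<open>S\<^sub>m\<close> to \<open>{0, \<dots>, 2 * m - 1}\<close>. So
  \<open>c\<^sub>m\<close> takes every value in that range exactly once, whatever was chosen before
  (\<open>card_arrangements_rank_sum\<close>).
\<close>

section \<open>Counting bounded sequences\<close>

text \<open>
  The number of sequences \<open>(c\<^sub>1, \<dots>, c\<^sub>m)\<close> with \<open>0 \<le> c\<^sub>j \<le> 2 * j - 1\<close> and sum \<open>k\<close>, the
  recursion splitting off \<open>c\<^sub>m\<close>.
\<close>
fun staircase_count :: "nat \<Rightarrow> nat \<Rightarrow> nat" where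
  "staircase_count 0 k = (if k = 0 then 1 else 0)"
| "staircase_count (Suc m) k = (\<Sum>c | c < 2 * Suc m \<and> c \<le> k. staircase_count m (k - c))"

section \<open>Tilings\<close>

text \<open>
  The condition on runs in \<^const>\<open>tilings_B\<close>, separated from the numbers of squares so that it can
  be followed through the removal of a suffix.
\<close>
definition run_bounded :: "square list \<Rightarrow> bool" where
  "run_bounded w \<longleftrightarrow>
     (\<forall>u l v. w = u @ replicate l Orange @ v \<and> l \<ge> 1 \<and>
              (u = [] \<or> last u = Green) \<and> (v = [] \<or> hd v = Green) \<longrightarrow>
              int l \<le> 2 * int (count_list u Green) - 1)"

lemma count_list_replicate: "count_list (replicate c x) y = (if x = y then c else 0)"
  by (induction c) auto

lemma Green_notin_iff: "Green \<notin> set w \<longleftrightarrow> w = replicate (length w) Orange"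
  by (induction w) (auto, metis square.exhaust)

lemma last_occurrence_unique:
  assumes "u @ x # v = u' @ x # v'" "x \<notin> set v" "x \<notin> set v'"
  shows "u = u' \<and> v = v'"
  using assms by (auto simp: append_eq_append_conv2 append_eq_Cons_conv Cons_eq_append_conv)

text \<open>
  The green square shields the runs of \<open>u\<close> from what follows it: a maximal run of the longer word
  is either the final block of orange squares or a maximal run of \<open>u\<close>, with the same squares to its
  left. The final block has one green square more than \<open>u\<close> before it, hence the bound
  \<open>2 * (j + 1) - 1 = 2 * j + 1\<close>.
\<close>
lemma run_bounded_append:
  "run_bounded (u @ Green # replicate c Orange) \<longleftrightarrow>
     run_bounded u \<and> c \<le> 2 * count_list u Green + 1"
  (is "run_bounded ?w \<longleftrightarrow> _")
proof
  assume w: "run_bounded ?w"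
  have "run_bounded u"
    unfolding run_bounded_def
  proof (intro allI impI, elim conjE)
    fix a l v
    assume *: "u = a @ replicate l Orange @ v" "1 \<le> l" "a = [] \<or> last a = Green"
      "v = [] \<or> hd v = Green"
    have "?w = a @ replicate l Orange @ (v @ Green # replicate c Orange)"
      using *(1) by simp
    moreover have "hd (v @ Green # replicate c Orange) = Green"
      using *(4) by (cases v) auto
    ultimately show "int l \<le> 2 * int (count_list a Green) - 1"
      using w *(2,3) unfolding run_bounded_def by blast
  qed
  moreover have "c \<le> 2 * count_list u Green + 1"
  proof (cases "c = 0")
    case False
    have "?w = (u @ [Green]) @ replicate c Orange @ []" by simp
    moreover have "last (u @ [Green]) = Green" by simp
    ultimately have "int c \<le> 2 * int (count_list (u @ [Green]) Green) - 1"
      using w False unfolding run_bounded_def by (metis One_nat_def Suc_leI neq0_conv)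
    then show ?thesis by simp
  qed simp
  ultimately show "run_bounded u \<and> c \<le> 2 * count_list u Green + 1" by blast
next
  assume u: "run_bounded u \<and> c \<le> 2 * count_list u Green + 1"
  show "run_bounded ?w"
    unfolding run_bounded_def
  proof (intro allI impI, elim conjE)
    fix a l v
    assume *: "?w = a @ replicate l Orange @ v" "1 \<le> l" "a = [] \<or> last a = Green"
      "v = [] \<or> hd v = Green"
    show "int l \<le> 2 * int (count_list a Green) - 1"
    proof (cases "v = []")
      \<comment> \<open>The run is a suffix of the word, so it is the final block.\<close>
      case True
      have "a \<noteq> []"
      proof
        assume "a = []"
        then have "set ?w \<subseteq> {Orange}" using *(1) True
          by (metis append.right_neutral append_Nil set_replicate_conv_if
              empty_subsetI order_refl)
        then show False by simp
      qed
      then have a: "a = butlast a @ [Green]" using *(3) by (metis append_butlast_last_id)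
      then have "u @ Green # replicate c Orange = butlast a @ Green # replicate l Orange"
        using *(1) True by (metis append.assoc append_Cons append_Nil append_Nil2)
      then have eq: "u = butlast a \<and> replicate c Orange = replicate l Orange"
        by (rule last_occurrence_unique) auto
      then have "c = l" by (metis length_replicate)
      moreover have "count_list a Green = count_list u Green + 1"
        using eq by (subst a) simp
      ultimately show ?thesis using u by simp
    next
      \<comment> \<open>A green square follows the run; the last one is the square after \<open>u\<close>, so the run lies in \<open>u\<close>.\<close>
      case False
      then have "Green \<in> set v" using *(4) by (metis hd_in_set)
      then obtain v1 v2 where v: "v = v1 @ Green # v2" "Green \<notin> set v2"
        by (meson split_list_last)
      have "u @ Green # replicate c Orange = (a @ replicate l Orange @ v1) @ Green # v2"
        using *(1) v(1) by simp
      then have "u = a @ replicate l Orange @ v1 \<and> replicate c Orange = v2"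
        using v(2) by (intro last_occurrence_unique) auto
      moreover have "v1 = [] \<or> hd v1 = Green" using *(4) v(1) by (cases v1) auto
      ultimately show ?thesis using u *(2,3) unfolding run_bounded_def by blast
    qed
  qed
qed

lemma length_eq_Green_plus_Orange:
  "length w = count_list w Green + count_list w Orange"
proof (induction w)
  case (Cons a w)
  then show ?case by (cases a) auto
qed simp

lemma tilings_B_iff:
  "w \<in> tilings_B n k \<longleftrightarrow>
     count_list w Green = n \<and> count_list w Orange = k \<and> run_bounded w"
  using length_eq_Green_plus_Orange[of w] by (auto simp: tilings_B_def run_bounded_def)

lemma finite_tilings_B: "finite (tilings_B n k)"
proof (rule finite_subset)
  show "tilings_B n k \<subseteq> {w. set w \<subseteq> {Green, Orange} \<and> length w = n + k}"
    using square.exhaust by (auto simp: tilings_B_def)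
qed (simp add: finite_lists_length_eq)

lemma tilings_B_0: "tilings_B 0 k = (if k = 0 then {[]} else {})"
proof -
  have "w = []" if "w \<in> tilings_B 0 k" for w
  proof (rule ccontr)
    assume "w \<noteq> []"
    have "Green \<notin> set w" using that by (simp add: tilings_B_iff count_list_0_iff)
    then have "w = [] @ replicate (length w) Orange @ []"
      using Green_notin_iff by simp
    then have "int (length w) \<le> 2 * int (count_list [] Green) - 1"
      using that \<open>w \<noteq> []\<close> unfolding tilings_B_iff run_bounded_def
      by (metis One_nat_def Suc_leI length_greater_0_conv)
    then show False by simp
  qed
  moreover have "run_bounded []" by (simp add: run_bounded_def)
  ultimately have "w \<in> tilings_B 0 k \<longleftrightarrow> w = [] \<and> k = 0" for w
    by (cases "w = []") (auto simp: tilings_B_iff)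
  then show ?thesis by auto
qed

lemma tilings_B_Suc:
  "tilings_B (Suc n) k =
     (\<Union>c\<in>{c. c < 2 * Suc n \<and> c \<le> k}. (\<lambda>u. u @ Green # replicate c Orange) ` tilings_B n (k - c))"
  (is "_ = ?R")
proof (intro equalityI subsetI)
  fix w assume w: "w \<in> tilings_B (Suc n) k"
  then have "Green \<in> set w" by (metis tilings_B_iff count_list_0_iff nat.distinct(1))
  then obtain u v where uv: "w = u @ Green # v" "Green \<notin> set v" by (meson split_list_last)
  then obtain c where w': "w = u @ Green # replicate c Orange" using Green_notin_iff by blast
  have "u \<in> tilings_B n (k - c)" "c < 2 * Suc n" "c \<le> k"
    using w by (auto simp: tilings_B_iff w' run_bounded_append count_list_replicate)
  then show "w \<in> ?R" using w' by blast
qed (auto simp: tilings_B_iff run_bounded_append count_list_replicate)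

lemma card_tilings_B: "card (tilings_B n k) = staircase_count n k"
proof (induction n arbitrary: k)
  case 0
  show ?case by (simp add: tilings_B_0)
next
  case (Suc n)
  let ?f = "\<lambda>c u. u @ Green # replicate c Orange"
  have "card (tilings_B (Suc n) k) =
      (\<Sum>c | c < 2 * Suc n \<and> c \<le> k. card (?f c ` tilings_B n (k - c)))"
    unfolding tilings_B_Suc
  proof (intro card_UN_disjoint ballI impI)
    fix c d :: nat assume "c \<noteq> d"
    have "c = d" if "?f c u = ?f d v" for u v
    proof -
      have "replicate c Orange = replicate d Orange"
        using last_occurrence_unique[OF that] by auto
      then show ?thesis by (metis length_replicate)
    qed
    then show "?f c ` tilings_B n (k - c) \<inter> ?f d ` tilings_B n (k - d) = {}"
      using \<open>c \<noteq> d\<close> by blast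
  qed (auto simp: finite_tilings_B)
  also have "\<dots> = (\<Sum>c | c < 2 * Suc n \<and> c \<le> k. staircase_count n (k - c))"
    by (intro sum.cong refl) (simp add: card_image inj_on_def Suc.IH)
  finally show ?case by simp
qed

section \<open>Signed arrangements and their rank sums\<close>

text \<open>
  The words of length \<open>m\<close> over \<open>S\<close> that use no absolute value twice (\<open>arrangements_iff\<close>),
  generated by successive choices so that the set of values still available is explicit.
\<close>
fun arrangements :: "nat \<Rightarrow> int set \<Rightarrow> int list set" where
  "arrangements 0 S = {[]}"
| "arrangements (Suc m) S = (\<Union>x\<in>S. (#) x ` arrangements m (S - {x, - x}))"

definition rank :: "'a::linorder set \<Rightarrow> 'a \<Rightarrow> nat" where
  "rank S x = card {y \<in> S. x < y}"

fun rank_sum :: "int set \<Rightarrow> int list \<Rightarrow> nat" where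
  "rank_sum S [] = 0"
| "rank_sum S (x # xs) = rank S x + rank_sum (S - {x, - x}) xs"

lemma bij_betw_rank:
  assumes "finite S"
  shows "bij_betw (rank S) S {..<card S}"
proof -
  have less: "rank S y < rank S x" if "x \<in> S" "y \<in> S" "x < y" for x y
    unfolding rank_def using that assms by (intro psubset_card_mono) auto
  have inj: "inj_on (rank S) S"
    by (rule inj_onI) (metis less less_irrefl linorder_neqE)
  have "rank S ` S \<subseteq> {..<card S}"
    using assms unfolding rank_def by (auto intro!: psubset_card_mono)
  then have "rank S ` S = {..<card S}"
    by (intro card_subset_eq) (auto simp: card_image[OF inj])
  with inj show ?thesis by (simp add: bij_betw_def)
qed

lemma finite_arrangements: "finite S \<Longrightarrow> finite (arrangements m S)"
  by (induction m arbitrary: S) auto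

text \<open>
  Only the size of the symmetric set \<open>S\<close> matters: after the first letter \<open>x\<close> the available values
  form the symmetric set \<open>S - {x, - x}\<close>, which has two elements less, and the rank of \<open>x\<close> runs
  bijectively through \<open>{0, \<dots>, 2 * m + 1}\<close> when \<open>S\<close> has \<open>2 * (m + 1)\<close> elements.
\<close>
lemma card_arrangements_rank_sum:
  assumes "finite S" "uminus ` S = S" "0 \<notin> S" "card S = 2 * m"
  shows "card {xs \<in> arrangements m S. rank_sum S xs = k} = staircase_count m k"
  using assms
proof (induction m arbitrary: S k)
  case 0
  have "{xs \<in> arrangements 0 S. rank_sum S xs = k} = (if k = 0 then {[]} else {})" by auto
  then show ?case by simp
next
  case (Suc m)
  let ?S' = "\<lambda>x. S - {x, - x}"
  let ?A = "\<lambda>x. {xs \<in> arrangements m (?S' x). rank_sum (?S' x) xs = k - rank S x}"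
  have IH: "card (?A x) = staircase_count m (k - rank S x)" if "x \<in> S" for x
  proof (rule Suc.IH)
    have "- x \<in> S" using that Suc.prems(2) by blast
    moreover have "x \<noteq> - x" using that Suc.prems(3) by auto
    ultimately show "card (?S' x) = 2 * m"
      using that Suc.prems(1,4) by (subst card_Diff_subset) auto
    show "uminus ` ?S' x = ?S' x"
      using Suc.prems(2) by (subst image_set_diff) auto
  qed (use Suc.prems in auto)
  have split: "{xs \<in> arrangements (Suc m) S. rank_sum S xs = k} =
      (\<Union>x\<in>{x \<in> S. rank S x \<le> k}. (#) x ` ?A x)"
    by auto
  have "card {xs \<in> arrangements (Suc m) S. rank_sum S xs = k} =
      (\<Sum>x | x \<in> S \<and> rank S x \<le> k. card ((#) x ` ?A x))"
    unfolding split using Suc.prems(1) by (intro card_UN_disjoint) (auto simp: finite_arrangements)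
  also have "\<dots> = (\<Sum>x | x \<in> S \<and> rank S x \<le> k. staircase_count m (k - rank S x))"
    by (intro sum.cong refl) (auto simp: card_image IH)
  also have "\<dots> = (\<Sum>c | c < 2 * Suc m \<and> c \<le> k. staircase_count m (k - c))"
  proof (rule sum.reindex_bij_betw)
    have bij: "bij_betw (rank S) S {..<2 * Suc m}"
      using bij_betw_rank[OF Suc.prems(1)] Suc.prems(4) by simp
    have "{c. c < 2 * Suc m \<and> c \<le> k} = {c \<in> rank S ` S. c \<le> k}"
      unfolding bij_betw_imp_surj_on[OF bij] by auto
    also have "\<dots> = rank S ` {x \<in> S. rank S x \<le> k}" by auto
    finally have "rank S ` {x \<in> S. rank S x \<le> k} = {c. c < 2 * Suc m \<and> c \<le> k}" ..
    then show "bij_betw (rank S) {x \<in> S. rank S x \<le> k} {c. c < 2 * Suc m \<and> c \<le> k}"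
      by (intro bij_betw_subset[OF bij]) auto
  qed
  finally show ?case by simp
qed

lemma arrangements_iff:
  "xs \<in> arrangements m S \<longleftrightarrow> length xs = m \<and> set xs \<subseteq> S \<and> distinct (map abs xs)"
proof (induction m arbitrary: S xs)
  case (Suc m)
  show ?case
  proof (cases xs)
    case (Cons x ys)
    have "\<bar>x\<bar> \<notin> abs ` set ys \<longleftrightarrow> x \<notin> set ys \<and> - x \<notin> set ys"
      by (auto simp: image_iff abs_eq_iff)
    then show ?thesis using Cons by (auto simp: Suc.IH image_iff)
  qed auto
qed auto

section \<open>Signed permutations as arrangements\<close>

text \<open>
  The window is read from right to left, because the contribution of position \<open>m\<close> to the inversion
  number compares \<open>\<pi>(m)\<close> with the positions to its left, which must therefore be still open.
\<close>
definition arrangement_of :: "nat \<Rightarrow> (int \<Rightarrow> int) \<Rightarrow> int list" where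
  "arrangement_of n \<pi> = map (\<lambda>j. \<pi> (int j)) (rev [1..<n + 1])"

lemma arrangement_of_Suc:
  "arrangement_of (Suc n) \<pi> = \<pi> (int (Suc n)) # arrangement_of n \<pi>"
  by (simp add: arrangement_of_def)

lemma length_arrangement_of: "length (arrangement_of n \<pi>) = n"
  by (simp add: arrangement_of_def del: upt_Suc)

lemma signed_range_cases:
  "j \<in> signed_range n \<longleftrightarrow> (\<exists>p\<in>{1..n}. j = int p \<or> j = - int p)"
  unfolding signed_range_def
  by (auto intro!: bexI[of _ "nat \<bar>j\<bar>"])

lemma finite_signed_range: "finite (signed_range n)"
  by (simp add: signed_range_def)

lemma card_signed_range: "card (signed_range n) = 2 * n"
  by (simp add: signed_range_def card_Diff_subset)

lemma signed_range_uminus: "uminus ` signed_range n = signed_range n"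
proof (intro equalityI subsetI)
  fix j assume "j \<in> signed_range n"
  then have "- j \<in> signed_range n" by (auto simp: signed_range_def)
  then show "j \<in> uminus ` signed_range n" by (rule rev_image_eqI) simp
qed (auto simp: signed_range_def)

context
  fixes n :: nat and \<pi> :: "int \<Rightarrow> int"
  assumes \<pi>: "\<pi> \<in> hyperoctahedral n"
begin

lemma signed_perm_permutes: "\<pi> permutes signed_range n"
  using \<pi> by (simp add: hyperoctahedral_def)

lemma signed_perm_odd: "1 \<le> p \<Longrightarrow> p \<le> n \<Longrightarrow> \<pi> (- int p) = - \<pi> (int p)"
  using \<pi> by (simp add: hyperoctahedral_def)

lemma signed_perm_inj: "inj \<pi>"
  using signed_perm_permutes by (rule permutes_inj)

text \<open>
  Write \<open>s = \<pi>(m)\<close> and count the elements above \<open>s\<close> in each pair \<open>{\<pi>(j), -\<pi>(j)}\<close>. For \<open>j < m\<close>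
  and \<open>s > 0\<close> there is one if \<open>\<bar>\<pi>(j)\<bar> > s\<close> and none otherwise. For \<open>j < m\<close> and \<open>s < 0\<close> there are
  two if \<open>\<bar>\<pi>(j)\<bar> < \<bar>s\<bar>\<close> and one otherwise, matching the weights 2 and 1 in the definition of
  \<^const>\<open>inv_at_B\<close>. The pair \<open>{s, - s}\<close> contributes one iff \<open>s < 0\<close>, which is the extra 1.
\<close>
lemma inv_at_B_eq_rank:
  assumes m: "1 \<le> m" "m \<le> n"
  shows "inv_at_B n (n + 1 - m) \<pi> = rank (\<pi> ` signed_range m) (\<pi> (int m))"
proof -
  define s where "s = \<pi> (int m)"
  \<comment> \<open>Indicators turn the cardinalities into sums over \<open>j\<close>, which are then compared term by term.\<close>
  define b where "b = (\<lambda>P. if P then 1 else 0 :: nat)"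
  have card_b: "card {j \<in> A. P j} = (\<Sum>j\<in>A. b (P j))" if "finite A" for A :: "nat set" and P
    using that by (simp add: b_def sum.If_cases Int_def conj_commute)
  have s0: "s \<noteq> 0"
    using permutes_in_image[OF signed_perm_permutes, of "int m"] m
    by (auto simp: s_def signed_range_def)
  have ne: "\<pi> (int j) \<noteq> s \<and> \<pi> (int j) \<noteq> - s" if "j \<in> {1..<m}" for j
  proof -
    have "\<pi> (int j) \<noteq> \<pi> (int m)" "\<pi> (int j) \<noteq> \<pi> (- int m)"
      using that by (simp_all add: inj_eq[OF signed_perm_inj])
    then show ?thesis using signed_perm_odd[OF m] by (simp add: s_def)
  qed
  have set_eq: "{y \<in> \<pi> ` signed_range m. s < y} =
      (\<lambda>j. \<pi> (int j)) ` {j \<in> {1..m}. s < \<pi> (int j)} \<union>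
      (\<lambda>j. \<pi> (- int j)) ` {j \<in> {1..m}. s < - \<pi> (int j)}"
  proof -
    have "signed_range m = int ` {1..m} \<union> (\<lambda>j. - int j) ` {1..m}"
      by (auto simp: signed_range_cases)
    then have "\<pi> ` signed_range m = (\<lambda>j. \<pi> (int j)) ` {1..m} \<union> (\<lambda>j. \<pi> (- int j)) ` {1..m}"
      by (simp add: image_Un image_image)
    then have "{y \<in> \<pi> ` signed_range m. s < y} =
        (\<lambda>j. \<pi> (int j)) ` {j \<in> {1..m}. s < \<pi> (int j)} \<union>
        (\<lambda>j. \<pi> (- int j)) ` {j \<in> {1..m}. s < \<pi> (- int j)}"
      by auto
    moreover have "{j \<in> {1..m}. s < \<pi> (- int j)} = {j \<in> {1..m}. s < - \<pi> (int j)}"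
      using m signed_perm_odd by auto
    ultimately show ?thesis by simp
  qed
  have "rank (\<pi> ` signed_range m) s =
      card {j \<in> {1..m}. s < \<pi> (int j)} + card {j \<in> {1..m}. s < - \<pi> (int j)}"
    unfolding rank_def set_eq
    by (subst card_Un_disjoint) (auto simp: card_image inj_on_def inj_eq[OF signed_perm_inj])
  also have "\<dots> = (\<Sum>j\<in>{1..m}. b (s < \<pi> (int j)) + b (s < - \<pi> (int j)))"
    unfolding card_b[OF finite_atLeastAtMost] sum.distrib ..
  also have "\<dots> = (\<Sum>j\<in>{1..<m}. b (s < \<pi> (int j)) + b (s < - \<pi> (int j))) + b (s < 0)"
    using m s0 by (subst atLeastLessThanSuc_atLeastAtMost[symmetric])
      (auto simp: sum.atLeastLessThan_Suc b_def s_def[symmetric])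
  finally have rank: "rank (\<pi> ` signed_range m) s = \<dots>" .
  have below: "card {j \<in> {1..n}. j < m \<and> P j} = (\<Sum>j\<in>{1..<m}. b (P j))" for P
  proof -
    have "{j \<in> {1..n}. j < m \<and> P j} = {j \<in> {1..<m}. P j}" using m by auto
    then show ?thesis by (simp only: card_b[OF finite_atLeastLessThan])
  qed
  have pos: "n + 1 - (n + 1 - m) = m" using m by simp
  have unsigned_less: "unsigned \<pi> i < unsigned \<pi> j \<longleftrightarrow> \<bar>\<pi> (int i)\<bar> < \<bar>\<pi> (int j)\<bar>" for i j
    by (auto simp: unsigned_def)
  have "inv_at_B n (n + 1 - m) \<pi> =
      (if s < 0 then 1 + 2 * (\<Sum>j\<in>{1..<m}. b (\<bar>\<pi> (int j)\<bar> < \<bar>s\<bar>)) else 0)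
      + (\<Sum>j\<in>{1..<m}. b (\<bar>s\<bar> < \<bar>\<pi> (int j)\<bar>))"
    unfolding inv_at_B_def inv_at_def Let_def pos below unsigned_less s_def[symmetric] sign_bit_def
    by simp
  also have "\<dots> = (\<Sum>j\<in>{1..<m}. b (s < \<pi> (int j)) + b (s < - \<pi> (int j))) + b (s < 0)"
  proof (cases "s < 0")
    case True
    have "(\<Sum>j\<in>{1..<m}. 2 * b (\<bar>\<pi> (int j)\<bar> < \<bar>s\<bar>) + b (\<bar>s\<bar> < \<bar>\<pi> (int j)\<bar>)) =
        (\<Sum>j\<in>{1..<m}. b (s < \<pi> (int j)) + b (s < - \<pi> (int j)))"
      using True by (intro sum.cong refl) (frule ne, auto simp: b_def)
    then show ?thesis using True by (simp add: sum.distrib sum_distrib_left b_def)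
  next
    case False
    have "(\<Sum>j\<in>{1..<m}. b (\<bar>s\<bar> < \<bar>\<pi> (int j)\<bar>)) =
        (\<Sum>j\<in>{1..<m}. b (s < \<pi> (int j)) + b (s < - \<pi> (int j)))"
      using False by (intro sum.cong refl) (auto simp: b_def)
    then show ?thesis using False by (simp add: b_def)
  qed
  finally show ?thesis using rank by (simp add: s_def)
qed

text \<open>
  The values available when \<open>\<pi>(m)\<close> is chosen are the images of \<open>{-m, \<dots>, m} - {0}\<close>; removing
  \<open>\<pi>(m)\<close> and \<open>-\<pi>(m) = \<pi>(-m)\<close> leaves the images for \<open>m - 1\<close>.
\<close>
lemma rank_sum_arrangement_of:
  "m \<le> n \<Longrightarrow> rank_sum (\<pi> ` signed_range m) (arrangement_of m \<pi>) =
     (\<Sum>j = 1..m. rank (\<pi> ` signed_range j) (\<pi> (int j)))"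
proof (induction m)
  case 0
  then show ?case by (simp add: arrangement_of_def)
next
  case (Suc m)
  have "\<pi> ` signed_range (Suc m) - {\<pi> (int (Suc m)), - \<pi> (int (Suc m))} =
      \<pi> ` (signed_range (Suc m) - {int (Suc m), - int (Suc m)})"
    using signed_perm_odd[of "Suc m"] Suc.prems by (simp add: image_set_diff signed_perm_inj)
  also have "signed_range (Suc m) - {int (Suc m), - int (Suc m)} = signed_range m"
    by (auto simp: signed_range_def)
  finally show ?case using Suc by (simp only: arrangement_of_Suc rank_sum.simps) simp
qed

lemma inv_B_eq_rank_sum: "inv_B n \<pi> = rank_sum (signed_range n) (arrangement_of n \<pi>)"
proof -
  have "inv_B n \<pi> = (\<Sum>j = 1..n. inv_at_B n (n + 1 - j) \<pi>)"
    unfolding inv_B_def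
    by (rule sum.reindex_bij_witness[of _ "\<lambda>i. n + 1 - i" "\<lambda>i. n + 1 - i"]) auto
  also have "\<dots> = (\<Sum>j = 1..n. rank (\<pi> ` signed_range j) (\<pi> (int j)))"
    by (intro sum.cong refl inv_at_B_eq_rank) auto
  also have "\<dots> = rank_sum (\<pi> ` signed_range n) (arrangement_of n \<pi>)"
    by (simp add: rank_sum_arrangement_of)
  finally show ?thesis by (simp add: permutes_image[OF signed_perm_permutes])
qed

lemma arrangement_of_in_arrangements: "arrangement_of n \<pi> \<in> arrangements n (signed_range n)"
proof -
  have "inj_on (abs \<circ> (\<lambda>j. \<pi> (int j))) {1..n}"
  proof (rule inj_onI)
    fix i j assume ij: "i \<in> {1..n}" "j \<in> {1..n}"
      and "(abs \<circ> (\<lambda>j. \<pi> (int j))) i = (abs \<circ> (\<lambda>j. \<pi> (int j))) j"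
    then have "unsigned \<pi> i = unsigned \<pi> j" by (simp add: unsigned_def)
    then show "i = j"
      using ij by (rule inj_onD[OF bij_betw_imp_inj_on[OF bij_betw_unsigned[OF \<pi>]]])
  qed
  moreover have "set (rev [1..<n + 1]) = {1..n}" by auto
  ultimately have "distinct (map abs (arrangement_of n \<pi>))"
    unfolding arrangement_of_def map_map distinct_map by simp
  moreover have "set (arrangement_of n \<pi>) \<subseteq> signed_range n"
    using permutes_in_image[OF signed_perm_permutes]
    by (auto simp: arrangement_of_def signed_range_cases)
  ultimately show ?thesis by (simp add: arrangements_iff length_arrangement_of)
qed

end

lemma inj_on_arrangement_of: "inj_on (arrangement_of n) (hyperoctahedral n)"
proof (rule inj_onI, rule ext)
  fix \<pi> \<rho> j
  assume \<pi>: "\<pi> \<in> hyperoctahedral n" and \<rho>: "\<rho> \<in> hyperoctahedral n"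
    and eq: "arrangement_of n \<pi> = arrangement_of n \<rho>"
  have eq': "\<pi> (int p) = \<rho> (int p)" if "p \<in> {1..n}" for p
  proof -
    have "p \<in> set (rev [1..<n + 1])" using that by auto
    then show ?thesis using eq unfolding arrangement_of_def map_eq_conv by blast
  qed
  show "\<pi> j = \<rho> j"
  proof (cases "j \<in> signed_range n")
    case True
    then show ?thesis
      using eq' signed_perm_odd[OF \<pi>] signed_perm_odd[OF \<rho>] by (auto simp: signed_range_cases)
  next
    case False
    then show ?thesis
      using signed_perm_permutes[OF \<pi>] signed_perm_permutes[OF \<rho>] by (simp add: permutes_not_in)
  qed
qed

lemma arrangement_of_surj:
  assumes "xs \<in> arrangements n (signed_range n)"
  shows "xs \<in> arrangement_of n ` hyperoctahedral n"
proof -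
  have len: "length xs = n" and sub: "set xs \<subseteq> signed_range n" and dist: "distinct (map abs xs)"
    using assms by (auto simp: arrangements_iff)
  \<comment> \<open>The value at \<open>p > 0\<close> is the letter at index \<open>n - p\<close>, the word being read from the right; the
    factor \<open>sgn j\<close> extends it oddly.\<close>
  define \<pi> where
    "\<pi> = (\<lambda>j. if j \<in> signed_range n then sgn j * xs ! (n - nat \<bar>j\<bar>) else j)"
  have idx: "n - nat \<bar>j\<bar> < n" if "j \<in> signed_range n" for j
    using that by (auto simp: signed_range_def)
  have val: "xs ! (n - nat \<bar>j\<bar>) \<in> signed_range n" if "j \<in> signed_range n" for j
    using idx[OF that] len sub by (metis nth_mem subsetD)
  have maps: "\<pi> ` signed_range n \<subseteq> signed_range n"
  proof (rule image_subsetI)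
    fix j assume j: "j \<in> signed_range n"
    then show "\<pi> j \<in> signed_range n"
      using val[OF j] by (auto simp: \<pi>_def sgn_if signed_range_def)
  qed
  have inj: "inj_on \<pi> (signed_range n)"
  proof (rule inj_onI)
    fix i j assume i: "i \<in> signed_range n" and j: "j \<in> signed_range n" and eq: "\<pi> i = \<pi> j"
    have nz: "i \<noteq> 0" "j \<noteq> 0" "xs ! (n - nat \<bar>i\<bar>) \<noteq> 0"
      using i j val[OF i] by (auto simp: signed_range_def)
    have "\<bar>xs ! (n - nat \<bar>i\<bar>)\<bar> = \<bar>xs ! (n - nat \<bar>j\<bar>)\<bar>"
      using arg_cong[OF eq, of abs] i j nz by (simp add: \<pi>_def abs_mult)
    then have "map abs xs ! (n - nat \<bar>i\<bar>) = map abs xs ! (n - nat \<bar>j\<bar>)"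
      using idx[OF i] idx[OF j] len by simp
    then have "n - nat \<bar>i\<bar> = n - nat \<bar>j\<bar>"
      using nth_eq_iff_index_eq[OF dist] idx[OF i] idx[OF j] len by simp
    moreover have "nat \<bar>i\<bar> \<le> n" "nat \<bar>j\<bar> \<le> n" using i j by (auto simp: signed_range_def)
    ultimately have "\<bar>i\<bar> = \<bar>j\<bar>" by linarith
    moreover from this have "sgn i = sgn j" using eq i j nz by (simp add: \<pi>_def)
    ultimately show "i = j" by (metis abs_mult_sgn mult.commute)
  qed
  have "\<pi> ` signed_range n = signed_range n"
    using finite_signed_range maps inj by (rule endo_inj_surj)
  with inj have "\<pi> permutes signed_range n"
    by (intro bij_imp_permutes) (auto simp: bij_betw_def \<pi>_def)
  moreover have "\<pi> (- j) = - \<pi> j" if "j \<in> {1..int n}" for j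
    using that by (simp add: \<pi>_def signed_range_def)
  ultimately have "\<pi> \<in> hyperoctahedral n" by (simp add: hyperoctahedral_def)
  moreover have "arrangement_of n \<pi> = xs"
  proof (rule nth_equalityI)
    fix i assume "i < length (arrangement_of n \<pi>)"
    then have i: "i < n" by (simp add: length_arrangement_of)
    then have "arrangement_of n \<pi> ! i = \<pi> (int (n - i))"
      by (simp add: arrangement_of_def rev_nth del: upt_Suc)
    also have "\<dots> = xs ! i" using i by (simp add: \<pi>_def signed_range_def nat_diff_distrib)
    finally show "arrangement_of n \<pi> ! i = xs ! i" .
  qed (simp add: length_arrangement_of len)
  ultimately show ?thesis by blast
qed

lemma bij_betw_arrangement_of:
  "bij_betw (arrangement_of n) (hyperoctahedral n) (arrangements n (signed_range n))"
  unfolding bij_betw_def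
  using inj_on_arrangement_of arrangement_of_in_arrangements arrangement_of_surj by blast

lemma mahonian_B_eq: "mahonian_B n k = staircase_count n k"
proof -
  let ?A = "{\<pi> \<in> hyperoctahedral n. inv_B n \<pi> = k}"
  let ?B = "{xs \<in> arrangements n (signed_range n). rank_sum (signed_range n) xs = k}"
  have "?B = arrangement_of n `
      {\<pi> \<in> hyperoctahedral n. rank_sum (signed_range n) (arrangement_of n \<pi>) = k}"
    unfolding bij_betw_imp_surj_on[OF bij_betw_arrangement_of, symmetric] by (rule Compr_image_eq)
  also have "{\<pi> \<in> hyperoctahedral n. rank_sum (signed_range n) (arrangement_of n \<pi>) = k} = ?A"
    by (rule Collect_cong, rule conj_cong) (simp_all only: inv_B_eq_rank_sum)
  finally have "arrangement_of n ` ?A = ?B" ..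
  moreover have "inj_on (arrangement_of n) ?A"
    by (rule inj_on_subset[OF inj_on_arrangement_of]) (rule Collect_restrict)
  ultimately have "card ?A = card ?B" using card_image by fastforce
  also have "\<dots> = staircase_count n k"
    by (rule card_arrangements_rank_sum)
      (simp_all add: finite_signed_range card_signed_range signed_range_uminus, simp add: signed_range_def)
  finally show ?thesis by (simp add: mahonian_B_def)
qed

theorem theorem3p13:
  fixes n k :: nat
  assumes "n \<ge> 1" and "k \<le> n ^ 2"
  shows "mahonian_B n k = card (tilings_B n k)"
  by (simp add: mahonian_B_eq card_tilings_B)

end
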